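(* Consider the plant $\dot x_p=Ax_p+B_1w+B_2u$, $z=C_1x_p+D_{11}w+D_{12}u$ with disturbance satisfying $w(t)^Tw(t)\le w_{max}^2$ and actuator limit $u_{lim}$ ($w_{max},u_{lim}>0$). Suppose there exist symmetric matrices $X_1>0$, $X_2>0$, a matrix $Y$, a square matrix $G$, a constant $\alpha_{new}>0$, small positive scalars $\epsilon_i<1$ ($i=1,2,3$) and a scalar $\gamma_{new}$ such that, with $\Pi=AG+B_2Y-\frac12G$, $$\left(\begin{array}{cccc} X_1+\Pi+\Pi^T & B_1 & G^TC_1^T+Y^TD_{12}^T & -X_1+G^T-2\epsilon_1\Pi\\ \star & -\gamma_{new}I & D_{11}^T & 0\\ \star&\star&-\gamma_{new}I & -2\epsilon_1(C_1G+D_{12}Y)\\ \star&\star&\star&-2\epsilon_1(G^T+G)\end{array}\right)<0,$$ $$\left(\begin{array}{ccc} X_2+\Pi+\Pi^T+\frac{\alpha_{new}}{2}(G+G^T) & B_1 & -X_2+G^T-2\epsilon_2(\Pi+\frac{\alpha_{new}}{2}G)\\ \star&-\alpha_{new}I&0\\ \star&\star&-2\epsilon_2(G^T+G)\end{array}\right)<0,$$ $$\left(\begin{array}{ccc} X_2-G-G^T & -Y^T & -X_2+G^T+2\epsilon_3G\\ \star&-\frac{u_{lim}^2}{w_{max}^2}I&2\epsilon_3Y\\ \star&\star&-2\epsilon_3(G^T+G)\end{array}\right)<0.$$ Then the closed-loop system with state feedback $u=Kx_p$, $K=YG^{-1}$, is internally stable, never saturates and has disturbance attenuation level $\gamma_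{new}$.
   Context: $\star$ denotes entries determined by symmetry; for symmetric matrices $M>0$ ($M<0$) means positive (negative) definite. The closed loop is $\dot x_p=(A+B_2K)x_p+B_1w$, $z=(C_1+D_{12}K)x_p+D_{11}w$. "Internally stable" means $A+B_2K$ is Hurwitz. "Never saturates" means $\|u(t)\|\le u_{lim}$ for all $t\ge0$ along trajectories starting from $x_p(0)=0$ under any disturbance with $w(t)^Tw(t)\le w_{max}^2$. "Disturbance attenuation level $\gamma_{new}$" means the $L_2$ gain from $w$ to $z$ (the $H_\infty$ norm of the closed-loop transfer function) is less than $\gamma_{new}$. *)

theory Defs
  imports "HOL-Analysis.Analysis"
begin

definition positive_definite :: "real^'n^'n \<Rightarrow> bool" where
  "positive_definite M \<longleftrightarrow> transpose M = M \<and> (\<forall>v. v \<noteq> 0 \<longrightarrow> v \<bullet> (M *v v) > 0)"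

definition negative_definite :: "real^'n^'n \<Rightarrow> bool" where
  "negative_definite M \<longleftrightarrow> transpose M = M \<and> (\<forall>v. v \<noteq> 0 \<longrightarrow> v \<bullet> (M *v v) < 0)"

text \<open>
  Block matrices are indexed by (nested, right-associated) sum types.
\<close>

definition block_row :: "real^'a^'m \<Rightarrow> real^'b^'m \<Rightarrow> real^('a + 'b)^'m" where
  "block_row M N = (\<chi> i j. case j of Inl k \<Rightarrow> M $ i $ k | Inr k \<Rightarrow> N $ i $ k)"

definition block_col :: "real^'n^'a \<Rightarrow> real^'n^'b \<Rightarrow> real^'n^('a + 'b)" where
  "block_col M N = (\<chi> i. case i of Inl k \<Rightarrow> M $ k | Inr k \<Rightarrow> N $ k)"

text \<open>
  The matrix with upper block row \<open>(P, Q)\<close> and lower right block \<open>R\<close>, whose lower left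
  block is determined by symmetry.
\<close>

definition sym_block :: "real^'a^'a \<Rightarrow> real^'b^'a \<Rightarrow> real^'b^'b \<Rightarrow> real^('a + 'b)^('a + 'b)" where
  "sym_block P Q R = block_col (block_row P Q) (block_row (transpose Q) R)"

text \<open>Arguments: the upper triangle, row by row.\<close>

definition sym_block3 ::
  "real^'a^'a \<Rightarrow> real^'b^'a \<Rightarrow> real^'c^'a \<Rightarrow>
   real^'b^'b \<Rightarrow> real^'c^'b \<Rightarrow>
   real^'c^'c \<Rightarrow> real^('a + 'b + 'c)^('a + 'b + 'c)" where
  "sym_block3 M11 M12 M13 M22 M23 M33 =
     sym_block M11 (block_row M12 M13) (sym_block M22 M23 M33)"

definition sym_block4 ::
  "real^'a^'a \<Rightarrow> real^'b^'a \<Rightarrow> real^'c^'a \<Rightarrow> real^'d^'a \<Rightarrow>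
   real^'b^'b \<Rightarrow> real^'c^'b \<Rightarrow> real^'d^'b \<Rightarrow>
   real^'c^'c \<Rightarrow> real^'d^'c \<Rightarrow>
   real^'d^'d \<Rightarrow> real^('a + 'b + 'c + 'd)^('a + 'b + 'c + 'd)" where
  "sym_block4 M11 M12 M13 M14 M22 M23 M24 M33 M34 M44 =
     sym_block M11 (block_row M12 (block_row M13 M14)) (sym_block3 M22 M23 M24 M33 M34 M44)"

definition complex_matrix :: "real^'n^'m \<Rightarrow> complex^'n^'m" where
  "complex_matrix M = (\<chi> i j. complex_of_real (M $ i $ j))"

definition hurwitz :: "real^'n^'n \<Rightarrow> bool" where
  "hurwitz M \<longleftrightarrow>
     (\<forall>s v. v \<noteq> 0 \<and> complex_matrix M *v v = s *s v \<longrightarrow> Re s < 0)"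

text \<open>
  Solutions of \<open>x' = A x + B w\<close> on \<open>[0, \<infinity>)\<close> with zero initial state, in the sense of
  Caratheodory: the input is only required to be measurable, and the differential equation is
  understood in its integrated form.
\<close>

definition zero_state_trajectory ::
  "real^'n^'n \<Rightarrow> real^'w^'n \<Rightarrow> (real \<Rightarrow> real^'w) \<Rightarrow> (real \<Rightarrow> real^'n) \<Rightarrow> bool" where
  "zero_state_trajectory A B w x \<longleftrightarrow>
     w \<in> borel_measurable (lebesgue_on {0..}) \<and>
     (\<forall>t\<ge>0. (\<lambda>s. A *v x s + B *v w s) absolutely_integrable_on {0..t} \<and>
             x t = integral {0..t} (\<lambda>s. A *v x s + B *v w s))"

text \<open>
  For the closed loop \<open>x' = A x + B w\<close>, \<open>u = K x\<close>.
\<close>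

definition never_saturates ::
  "real^'n^'n \<Rightarrow> real^'w^'n \<Rightarrow> real^'n^'u \<Rightarrow> real \<Rightarrow> real \<Rightarrow> bool" where
  "never_saturates A B K w_max u_lim \<longleftrightarrow>
     (\<forall>w x. zero_state_trajectory A B w x \<and> (\<forall>t\<ge>0. w t \<bullet> w t \<le> w_max\<^sup>2) \<longrightarrow>
            (\<forall>t\<ge>0. norm (K *v x t) \<le> u_lim))"

definition L2_norm :: "(real \<Rightarrow> real^'k) \<Rightarrow> ennreal" where
  "L2_norm f =
     (let E = \<integral>\<^sup>+ t. ennreal ((norm (f t))\<^sup>2) \<partial>lebesgue_on {0..}
      in if E = \<infinity> then \<infinity> else ennreal (sqrt (enn2real E)))"

definition L2_gain ::
  "real^'n^'n \<Rightarrow> real^'w^'n \<Rightarrow> real^'n^'z \<Rightarrow> real^'w^'z \<Rightarrow> ennreal" where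
  "L2_gain A B C D =
     (SUP (w, x) \<in> {(w, x). zero_state_trajectory A B w x \<and> 0 < L2_norm w \<and> L2_norm w < \<infinity>}.
        L2_norm (\<lambda>t. C *v x t + D *v w t) / L2_norm w)"

definition transfer_function ::
  "real^'n^'n \<Rightarrow> real^'w^'n \<Rightarrow> real^'n^'z \<Rightarrow> real^'w^'z \<Rightarrow> complex \<Rightarrow> complex^'w^'z" where
  "transfer_function A B C D s =
     complex_matrix C ** matrix_inv (mat s - complex_matrix A) ** complex_matrix B
       + complex_matrix D"

text \<open>
  Supremum over the open right half plane of the largest singular value, i.e. of the operator
  norm induced by the Euclidean norms.
\<close>

definition Hinf_norm :: "(complex \<Rightarrow> complex^'w^'z) \<Rightarrow> ennreal" where
  "Hinf_norm T = (SUP s \<in> {s. Re s > 0}. ennreal (onorm ((*v) (T s))))"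

text \<open>
  For a stable system the \<open>L\<^sub>2\<close> gain and the \<open>H\<^sub>\<infinity>\<close> norm coincide. To avoid building that
  theorem into the definition, the bound is required of both.
\<close>

definition disturbance_attenuation_level ::
  "real^'n^'n \<Rightarrow> real^'w^'n \<Rightarrow> real^'n^'z \<Rightarrow> real^'w^'z \<Rightarrow> real \<Rightarrow> bool" where
  "disturbance_attenuation_level A B C D \<gamma> \<longleftrightarrow>
     L2_gain A B C D < ennreal \<gamma> \<and> Hinf_norm (transfer_function A B C D) < ennreal \<gamma>"

end

theory Submission
  imports Defs
begin

text \<open>
  Each of the three matrix inequalities is the extended form of a classical one: in its last
  block row and column stands a slack variable \<open>e\<close>. It decouples the Lyapunov matrix \<open>X\<close> from the
  matrix \<open>G\<close> that determines \<open>K\<close>, so that different \<open>X\<^sub>1\<close> and \<open>X\<^sub>2\<close> can share one \<open>G\<close>. Write \<open>\<A> = A + B\<^sub>2 K\<close> and \<open>\<C> = C\<^sub>1 + D\<^sub>1\<^sub>2 K\<close>. Since \<open>Y = K G\<close>, every occurrence of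
  \<open>G\<close> in the quadratic form of such an inequality can be collected in a single product
  \<open>2 r\<^sup>T G (v - 2 \<epsilon> e)\<close>, where \<open>r\<close> is \<open>e\<close> plus a linear function of the other variables. Choosing
  \<open>e\<close> such that \<open>r = 0\<close> eliminates \<open>G\<close>, and in the first inequality leaves
  \<open>2 v\<^sup>T X \<A>\<^sup>T v + 2 v\<^sup>T X \<C>\<^sup>T q + 2 v\<^sup>T B\<^sub>1 w + 2 q\<^sup>T D w - \<gamma> w\<^sup>T w - \<gamma> q\<^sup>T q < 0\<close>. With
  \<open>Q = X\<^sup>-\<^sup>1\<close> and \<open>v = Q x\<close> this is a dissipation inequality for the storage function
  \<open>V(x) = x\<^sup>T Q x\<close>.

  For the first inequality (\<open>bounded_real_LMI\<close>) the choice \<open>q = z/\<gamma>\<close> gives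
  \<open>V' + |z|\<^sup>2/\<gamma> \<le> (\<gamma> - \<delta>) |w|\<^sup>2\<close>. The margin \<open>\<delta> > 0\<close>, which comes from compactness of the unit
  sphere, is what makes the attenuation bound strict. For \<open>w = 0\<close> and \<open>q = 0\<close> the reduced
  inequality is a strict Lyapunov inequality, so \<open>\<A>\<close> is Hurwitz. Integrated along a trajectory, it bounds the \<open>L\<^sub>2\<close> gain by
  \<open>sqrt (\<gamma> (\<gamma> - \<delta>)) < \<gamma>\<close>. Applied to the real and imaginary parts of a solution of
  \<open>s x = \<A> x + B\<^sub>1 w\<close> with \<open>Re s > 0\<close>, where \<open>V'\<close> turns into \<open>2 Re s V \<ge> 0\<close>, it bounds the transfer
  function by the same constant.

  The second inequality (\<open>reachable_set_LMI\<close>) becomes \<open>V' \<le> \<alpha> (|w|\<^sup>2 - V)\<close>. So \<open>V\<close> cannot exceed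
  \<open>w\<^sub>m\<^sub>a\<^sub>x\<^sup>2\<close> when started at \<open>0\<close>: where it is larger, it does not increase. The third one (\<open>input_bound_LMI\<close>)
  becomes \<open>|K x|\<^sup>2 \<le> (u\<^sub>l\<^sub>i\<^sub>m\<^sup>2 / w\<^sub>m\<^sub>a\<^sub>x\<^sup>2) V(x)\<close> for the same \<open>V\<close>, hence \<open>|u| \<le> u\<^sub>l\<^sub>i\<^sub>m\<close>.

  Trajectories are only absolutely continuous, so \<open>V(x(t)) = \<integral> 2 (Q x)\<^sup>T x'\<close> needs an argument of its
  own: \<open>quadratic_form_of_indefinite_integral\<close>.
\<close>

section \<open>Quadratic forms of block matrices\<close>

definition stack :: "real^'a \<Rightarrow> real^'b \<Rightarrow> real^('a + 'b)" where
  "stack u v = (\<chi> i. case i of Inl k \<Rightarrow> u $ k | Inr k \<Rightarrow> v $ k)"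

lemma sum_over_sum_type:
  fixes f :: "'a::finite + 'b::finite \<Rightarrow> 'c::comm_monoid_add"
  shows "(\<Sum>i\<in>UNIV. f i) = (\<Sum>i\<in>UNIV. f (Inl i)) + (\<Sum>i\<in>UNIV. f (Inr i))"
  by (simp add: UNIV_Plus_UNIV[symmetric] sum.Plus del: UNIV_Plus_UNIV)

lemma inner_stack: "stack u v \<bullet> stack u' v' = u \<bullet> u' + v \<bullet> v'"
  by (simp add: stack_def inner_vec_def sum_over_sum_type)

lemma stack_eq_0_iff: "stack u v = 0 \<longleftrightarrow> u = 0 \<and> v = 0"
  by (metis add_nonneg_eq_0_iff inner_eq_zero_iff inner_ge_zero inner_stack)

lemma block_row_mult_stack: "block_row M N *v stack u v = M *v u + N *v v"
  by (simp add: block_row_def stack_def matrix_vector_mult_def vec_eq_iff sum_over_sum_type)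

lemma block_col_mult: "block_col M N *v u = stack (M *v u) (N *v u)"
  by (auto simp: block_col_def stack_def matrix_vector_mult_def vec_eq_iff split: sum.split)

lemma inner_transpose:
  fixes M :: "real^'n^'m"
  shows "v \<bullet> (transpose M *v u) = u \<bullet> (M *v v)" and "(transpose M *v u) \<bullet> v = u \<bullet> (M *v v)"
  by (metis dot_lmul_matrix inner_commute transpose_matrix_vector)+

lemma uminus_matrix_vector_mult: "(- M) *v x = - (M *v (x :: real^'n))"
  by (simp add: matrix_vector_mult_def vec_eq_iff sum_negf)

lemma inner_sym_block:
  "stack u v \<bullet> (sym_block P Q R *v stack u v) = u \<bullet> (P *v u) + 2 * (u \<bullet> (Q *v v)) + v \<bullet> (R *v v)"
proof -
  have "v \<bullet> (transpose Q *v u) = u \<bullet> (Q *v v)"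
    by (rule inner_transpose)
  then show ?thesis
    by (simp only: sym_block_def block_col_mult block_row_mult_stack inner_stack inner_add_right)
qed

lemma inner_sym_block3:
  "stack u (stack v w) \<bullet> (sym_block3 M11 M12 M13 M22 M23 M33 *v stack u (stack v w)) =
     u \<bullet> (M11 *v u) + 2 * (u \<bullet> (M12 *v v)) + 2 * (u \<bullet> (M13 *v w))
     + v \<bullet> (M22 *v v) + 2 * (v \<bullet> (M23 *v w)) + w \<bullet> (M33 *v w)"
  unfolding sym_block3_def inner_sym_block block_row_mult_stack inner_add_right by simp

lemma inner_sym_block4:
  "stack u (stack v (stack w y)) \<bullet>
     (sym_block4 M11 M12 M13 M14 M22 M23 M24 M33 M34 M44 *v stack u (stack v (stack w y))) =
     u \<bullet> (M11 *v u) + 2 * (u \<bullet> (M12 *v v)) + 2 * (u \<bullet> (M13 *v w)) + 2 * (u \<bullet> (M14 *v y))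
     + v \<bullet> (M22 *v v) + 2 * (v \<bullet> (M23 *v w)) + 2 * (v \<bullet> (M24 *v y))
     + w \<bullet> (M33 *v w) + 2 * (w \<bullet> (M34 *v y)) + y \<bullet> (M44 *v y)"
  unfolding sym_block4_def inner_sym_block inner_sym_block3 block_row_mult_stack inner_add_right
  by simp

section \<open>Definite matrices\<close>

text \<open>
  The maximum of the quadratic form over the unit sphere is attained, hence negative; homogeneity
  carries the bound to all vectors.
\<close>
lemma negative_definite_uniform:
  fixes M :: "real^'n^'n"
  assumes "negative_definite M"
  obtains \<delta> where "\<delta> > 0" "\<And>v. v \<bullet> (M *v v) \<le> - \<delta> * (v \<bullet> v)"
proof -
  let ?S = "sphere (0::real^'n) 1"
  have "continuous_on ?S (\<lambda>v. v \<bullet> (M *v v))"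
    by (intro continuous_intros linear_continuous_on matrix_vector_mul_bounded_linear)
  moreover have "?S \<noteq> {}"
    by (metis norm_axis_1 mem_sphere_0 empty_iff)
  ultimately obtain s where s: "s \<in> ?S" and max: "\<And>v. v \<in> ?S \<Longrightarrow> v \<bullet> (M *v v) \<le> s \<bullet> (M *v s)"
    using continuous_attains_sup[OF compact_sphere, of 0 1 "\<lambda>v. v \<bullet> (M *v v)"] by blast
  have "s \<noteq> 0" using s by auto
  show ?thesis
  proof (rule that)
    show "- (s \<bullet> (M *v s)) > 0"
      using assms \<open>s \<noteq> 0\<close> by (simp add: negative_definite_def)
    fix v :: "real^'n"
    show "v \<bullet> (M *v v) \<le> - (- (s \<bullet> (M *v s))) * (v \<bullet> v)"
    proof (cases "v = 0")
      case False
      have "v \<bullet> (M *v v) = (norm v)\<^sup>2 * (sgn v \<bullet> (M *v sgn v))"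
        using False by (simp add: sgn_div_norm matrix_vector_mult_scaleR power2_eq_square field_simps)
      also have "\<dots> \<le> (norm v)\<^sup>2 * (s \<bullet> (M *v s))"
        using False by (intro mult_left_mono max) (auto simp: norm_sgn)
      finally show ?thesis by (simp add: power2_norm_eq_inner mult.commute)
    qed simp
  qed
qed

lemma positive_definite_nonneg: "positive_definite M \<Longrightarrow> 0 \<le> v \<bullet> (M *v v)"
  unfolding positive_definite_def by (metis inner_zero_left order_le_less)

lemma positive_definite_inner_commute:
  assumes "positive_definite M"
  shows "v \<bullet> (M *v u) = u \<bullet> (M *v v)"
  using assms inner_transpose(1)[of v M u] by (simp add: positive_definite_def del: transpose_matrix_vector)

lemma matrix_inv_right:
  fixes M :: "'a::field^'n^'n"
  assumes "invertible M"
  shows "M ** matrix_inv M = mat 1"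
  using someI_ex[OF assms[unfolded invertible_def]] by (simp add: matrix_inv_def)

lemma positive_definite_inverse:
  fixes X :: "real^'n^'n"
  assumes "positive_definite X"
  obtains Q where "positive_definite Q" "\<And>x. X *v (Q *v x) = x"
proof -
  have "\<forall>x. X *v x = 0 \<longrightarrow> x = 0"
    using assms by (metis positive_definite_def inner_zero_right less_irrefl)
  then have "invertible X"
    by (simp add: invertible_left_inverse matrix_left_invertible_ker)
  then have XQ: "X ** matrix_inv X = mat 1"
    by (simp add: matrix_inv_right)
  have sym: "transpose X = X" using assms by (simp add: positive_definite_def)
  have inv: "X *v (matrix_inv X *v x) = x" for x
    by (simp add: matrix_vector_mul_assoc XQ)
  have "transpose (matrix_inv X) ** X = mat 1"
    by (metis XQ matrix_transpose_mul sym transpose_mat)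
  then have "transpose (matrix_inv X) = matrix_inv X"
    by (metis XQ matrix_mul_assoc matrix_mul_lid matrix_mul_rid)
  moreover have "v \<bullet> (matrix_inv X *v v) > 0" if "v \<noteq> 0" for v
  proof -
    have "matrix_inv X *v v \<noteq> 0" using inv[of v] that by auto
    then show ?thesis
      using assms inv[of v] by (metis positive_definite_def inner_commute)
  qed
  ultimately have "positive_definite (matrix_inv X)" by (simp add: positive_definite_def)
  then show ?thesis using inv that by blast
qed

text \<open>
  A kernel vector of \<open>G\<close> makes the quadratic form of \<open>G\<^sup>T + G\<close> vanish.
\<close>
lemma invertible_if_symmetric_part_positive:
  fixes G :: "real^'n^'n"
  assumes "\<And>v. v \<noteq> 0 \<Longrightarrow> v \<bullet> ((transpose G + G) *v v) > 0"
  shows "invertible G"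
proof -
  have "v = 0" if "G *v v = 0" for v
  proof (rule ccontr)
    assume "v \<noteq> 0"
    then have "v \<bullet> ((transpose G + G) *v v) > 0" by (rule assms)
    then show False
      using that by (simp add: matrix_vector_mult_add_rdistrib inner_add_right dot_lmul_matrix inner_commute[of v])
  qed
  then show ?thesis by (simp add: invertible_left_inverse matrix_left_invertible_ker)
qed

section \<open>Elimination of the slack variable\<close>

lemmas quadratic_form_expand =
  matrix_vector_mult_add_rdistrib matrix_vector_mult_diff_rdistrib
  matrix_vector_mult_diff_distrib matrix_vector_mult_scaleR
  uminus_matrix_vector_mult matrix_vector_mul_assoc[symmetric] scaleR_matrix_vector_assoc[symmetric]
  inner_transpose dot_lmul_matrix inner_add_left inner_add_right inner_diff_left inner_diff_right

text \<open>
  The bounded real lemma in the form used later: stability, and dissipation with a margin \<open>\<delta>\<close>. The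
  identity \<open>form\<close> in the proof shows why the terms with the free matrix \<open>G\<close> can be removed: they
  form a single product, one factor of which is zero for a suitable slack vector \<open>e\<close>.
\<close>
lemma bounded_real_LMI:
  fixes A G X :: "real^'n^'n" and B1 :: "real^'w^'n" and C :: "real^'n^'z" and D :: "real^'w^'z"
  assumes X: "positive_definite X"
    and P: "P = A ** G - (1/2) *\<^sub>R G"
    and lmi: "negative_definite (sym_block4
           (X + P + transpose P)  B1 (transpose G ** transpose C)
             (- X + transpose G - (2 * \<epsilon>) *\<^sub>R P)
           ((- \<gamma>) *\<^sub>R mat 1)  (transpose D)  0
           ((- \<gamma>) *\<^sub>R mat 1)  ((- 2 * \<epsilon>) *\<^sub>R (C ** G))
           ((- 2 * \<epsilon>) *\<^sub>R (transpose G + G)))"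
  obtains Q \<delta> where "positive_definite Q" "\<delta> > 0" "\<gamma> > 0"
    "\<And>x. x \<noteq> 0 \<Longrightarrow> (Q *v x) \<bullet> (A *v x) < 0"
    "\<And>x w. 2 * ((Q *v x) \<bullet> (A *v x + B1 *v w)) + (norm (C *v x + D *v w))\<^sup>2 / \<gamma> \<le> (\<gamma> - \<delta>) * (norm w)\<^sup>2"
proof -
  obtain Q where Q: "positive_definite Q" and XQ: "\<And>x. X *v (Q *v x) = x"
    using positive_definite_inverse[OF X] by blast
  let ?M = "sym_block4
           (X + P + transpose P)  B1 (transpose G ** transpose C)
             (- X + transpose G - (2 * \<epsilon>) *\<^sub>R P)
           ((- \<gamma>) *\<^sub>R mat 1)  (transpose D)  0
           ((- \<gamma>) *\<^sub>R mat 1)  ((- 2 * \<epsilon>) *\<^sub>R (C ** G))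
           ((- 2 * \<epsilon>) *\<^sub>R (transpose G + G))"
  obtain \<delta> where "\<delta> > 0" and \<delta>: "\<And>v. v \<bullet> (?M *v v) \<le> - \<delta> * (v \<bullet> v)"
    using negative_definite_uniform[OF lmi] by blast
  have form: "stack v (stack w (stack q e)) \<bullet> (?M *v stack v (stack w (stack q e)))
     = 2 * ((v v* A - (1/2) *\<^sub>R v + q v* C + e) \<bullet> (G *v (v - (2*\<epsilon>) *\<^sub>R e)))
       + v \<bullet> (X *v v) - 2 * (e \<bullet> (X *v v)) + 2 * (v \<bullet> (B1 *v w)) + 2 * (q \<bullet> (D *v w))
       - \<gamma> * (w \<bullet> w) - \<gamma> * (q \<bullet> q)" for v w q e
    unfolding inner_sym_block4 P
    by (simp add: quadratic_form_expand positive_definite_inner_commute[OF X, of v e] algebra_simps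
        del: transpose_matrix_vector)
  have key: "2 * ((Q *v x) \<bullet> (A *v x + B1 *v w)) + 2 * (q \<bullet> (C *v x + D *v w)) - \<gamma> * (w \<bullet> w) - \<gamma> * (q \<bullet> q)
      \<le> - \<delta> * ((Q *v x) \<bullet> (Q *v x) + w \<bullet> w)" for x w q
  proof -
    define v where "v = Q *v x"
    \<comment> \<open>the slack vector for which the factor in front of \<open>G\<close> is zero\<close>
    define e where "e = (1/2) *\<^sub>R v - v v* A - q v* C"
    have "2 * (v \<bullet> (A *v x + B1 *v w)) + 2 * (q \<bullet> (C *v x + D *v w)) - \<gamma> * (w \<bullet> w) - \<gamma> * (q \<bullet> q)
        \<le> - \<delta> * (v \<bullet> v + (w \<bullet> w + (q \<bullet> q + e \<bullet> e)))"
      using \<delta>[of "stack v (stack w (stack q e))"] XQ[of x]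
      unfolding form inner_stack v_def[symmetric]
      by (simp add: e_def inner_diff_left inner_add_right dot_lmul_matrix)
    also have "\<dots> \<le> - \<delta> * (v \<bullet> v + w \<bullet> w)"
      using \<open>\<delta> > 0\<close> by simp
    finally show ?thesis by (simp add: v_def)
  qed
  obtain w1 :: "real^'w" where "w1 \<bullet> w1 = 1" by (metis norm_axis_1 norm_eq_1)
  with key[of 0 w1 0] \<open>\<delta> > 0\<close> have "\<gamma> > 0" by simp
  show ?thesis
  proof (rule that[OF Q \<open>\<delta> > 0\<close> \<open>\<gamma> > 0\<close>])
    fix x :: "real^'n" assume "x \<noteq> 0"
    then have "Q *v x \<noteq> 0" using XQ[of x] by auto
    then have "\<delta> * ((Q *v x) \<bullet> (Q *v x)) > 0" using \<open>\<delta> > 0\<close> by simp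
    then show "(Q *v x) \<bullet> (A *v x) < 0" using key[of x 0 0] by simp
  next
    fix x :: "real^'n" and w :: "real^'w"
    define z where "z = C *v x + D *v w"
    \<comment> \<open>the multiplier \<open>q = z / \<gamma>\<close> maximises \<open>2 q \<bullet> z - \<gamma> (q \<bullet> q)\<close>\<close>
    have "2 * (((1/\<gamma>) *\<^sub>R z) \<bullet> z) - \<gamma> * (((1/\<gamma>) *\<^sub>R z) \<bullet> ((1/\<gamma>) *\<^sub>R z)) = (z \<bullet> z) / \<gamma>"
      using \<open>\<gamma> > 0\<close> by (simp add: field_simps)
    moreover have "0 \<le> \<delta> * ((Q *v x) \<bullet> (Q *v x))" using \<open>\<delta> > 0\<close> by simp
    ultimately show "2 * ((Q *v x) \<bullet> (A *v x + B1 *v w)) + (norm (C *v x + D *v w))\<^sup>2 / \<gamma>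
        \<le> (\<gamma> - \<delta>) * (norm w)\<^sup>2"
      using key[of x w "(1/\<gamma>) *\<^sub>R z"]
      by (simp add: z_def[symmetric] power2_norm_eq_inner algebra_simps)
  qed
qed

text \<open>
  The same elimination, with \<open>A + (\<alpha>/2) I\<close> in place of \<open>A\<close>; the shift by \<open>\<alpha>/2\<close> produces the decay
  term \<open>- \<alpha> V\<close>. It makes the ellipsoid \<open>x \<bullet> (Q *v x) \<le> c\<close> invariant under inputs with
  \<open>|w|\<^sup>2 \<le> c\<close>.
\<close>
lemma reachable_set_LMI:
  fixes A G X Q :: "real^'n^'n" and B1 :: "real^'w^'n"
  assumes X: "positive_definite X" and XQ: "\<And>x. X *v (Q *v x) = x"
    and P: "P = A ** G - (1/2) *\<^sub>R G"
    and lmi: "negative_definite (sym_block3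
           (X + P + transpose P + (\<alpha> / 2) *\<^sub>R (G + transpose G))  B1
             (- X + transpose G - (2 * \<epsilon>) *\<^sub>R (P + (\<alpha> / 2) *\<^sub>R G))
           ((- \<alpha>) *\<^sub>R mat 1)  0
           ((- 2 * \<epsilon>) *\<^sub>R (transpose G + G)))"
  shows "2 * ((Q *v x) \<bullet> (A *v x + B1 *v w)) \<le> \<alpha> * ((norm w)\<^sup>2 - x \<bullet> (Q *v x))"
proof -
  let ?M = "sym_block3
           (X + P + transpose P + (\<alpha> / 2) *\<^sub>R (G + transpose G))  B1
             (- X + transpose G - (2 * \<epsilon>) *\<^sub>R (P + (\<alpha> / 2) *\<^sub>R G))
           ((- \<alpha>) *\<^sub>R mat 1)  0
           ((- 2 * \<epsilon>) *\<^sub>R (transpose G + G))"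
  have form: "stack v (stack w e) \<bullet> (?M *v stack v (stack w e))
     = 2 * ((v v* A - (1/2) *\<^sub>R v + (\<alpha>/2) *\<^sub>R v + e) \<bullet> (G *v (v - (2*\<epsilon>) *\<^sub>R e)))
       + v \<bullet> (X *v v) - 2 * (e \<bullet> (X *v v)) + 2 * (v \<bullet> (B1 *v w)) - \<alpha> * (w \<bullet> w)" for v w e
    unfolding inner_sym_block3 P
    by (simp add: quadratic_form_expand positive_definite_inner_commute[OF X, of v e] algebra_simps
        del: transpose_matrix_vector)
  define v where "v = Q *v x"
  define e where "e = (1/2) *\<^sub>R v - (\<alpha>/2) *\<^sub>R v - v v* A"
  have "stack v (stack w e) \<bullet> (?M *v stack v (stack w e)) \<le> 0"
    using lmi unfolding negative_definite_def
    by (metis inner_zero_left order_le_less)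
  then show ?thesis
    using XQ[of x] unfolding form v_def[symmetric]
    by (simp add: e_def inner_diff_left inner_add_right dot_lmul_matrix power2_norm_eq_inner
        inner_commute[of x] algebra_simps)
qed

text \<open>
  Here the elimination leaves \<open>- (v \<bullet> x) - 2 (q \<bullet> K x) - c (q \<bullet> q) \<le> 0\<close> for \<open>v = Q x\<close> and all \<open>q\<close>; this
  is a Schur complement, and \<open>q = - K x / c\<close> is the vector that maximises the left side.
\<close>
lemma input_bound_LMI:
  fixes G X Q :: "real^'n^'n" and K :: "real^'n^'u"
  assumes X: "positive_definite X" and XQ: "\<And>x. X *v (Q *v x) = x"
    and "c > 0" and Y: "Y = K ** G"
    and lmi: "negative_definite (sym_block3
           (X - G - transpose G)  (- transpose Y)
             (- X + transpose G + (2 * \<epsilon>) *\<^sub>R G)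
           ((- c) *\<^sub>R mat 1)  ((2 * \<epsilon>) *\<^sub>R Y)
           ((- 2 * \<epsilon>) *\<^sub>R (transpose G + G)))"
  shows "(norm (K *v x))\<^sup>2 \<le> c * (x \<bullet> (Q *v x))"
proof -
  let ?M = "sym_block3
           (X - G - transpose G)  (- transpose Y)
             (- X + transpose G + (2 * \<epsilon>) *\<^sub>R G)
           ((- c) *\<^sub>R mat 1)  ((2 * \<epsilon>) *\<^sub>R Y)
           ((- 2 * \<epsilon>) *\<^sub>R (transpose G + G))"
  have form: "stack v (stack q e) \<bullet> (?M *v stack v (stack q e))
     = 2 * ((e - v - q v* K) \<bullet> (G *v (v - (2*\<epsilon>) *\<^sub>R e)))
       + v \<bullet> (X *v v) - 2 * (e \<bullet> (X *v v)) - c * (q \<bullet> q)" for v q e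
    unfolding inner_sym_block3 Y
    by (simp add: quadratic_form_expand positive_definite_inner_commute[OF X, of v e] algebra_simps
        del: transpose_matrix_vector)
  define v where "v = Q *v x"
  define q where "q = - (1/c) *\<^sub>R (K *v x)"
  define e where "e = v + q v* K"
  have "stack v (stack q e) \<bullet> (?M *v stack v (stack q e)) \<le> 0"
    using lmi unfolding negative_definite_def
    by (metis inner_zero_left order_le_less)
  then have "- (v \<bullet> x) - 2 * (q \<bullet> (K *v x)) - c * (q \<bullet> q) \<le> 0"
    using XQ[of x] unfolding form v_def[symmetric]
    by (simp add: e_def inner_add_left dot_lmul_matrix)
  then show ?thesis
    using \<open>c > 0\<close> by (simp add: q_def v_def[symmetric] power2_norm_eq_inner inner_commute[of x] field_simps)
qed

section \<open>Storage functions along trajectories\<close>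

text \<open>
  The chain rule for \<open>x\<^sup>T Q x\<close> along an indefinite Lebesgue integral, without differentiating \<open>x\<close>. On
  an interval \<open>[a, b]\<close> symmetry of \<open>Q\<close> gives
  \<open>x(b)\<^sup>T Q x(b) - x(a)\<^sup>T Q x(a) = (Q x(a) + Q x(b))\<^sup>T \<integral> f\<close>. This differs from \<open>\<integral> 2 (Q x)\<^sup>T f\<close> by at
  most \<open>2 \<eta> \<integral> |f|\<close> if \<open>Q x\<close> oscillates by at most \<open>\<eta>\<close> on the interval. By uniform continuity
  \<open>[0, t]\<close> splits into finitely many such intervals, and the errors add up to \<open>2 \<eta> \<integral> |f|\<close> over
  \<open>[0, t]\<close>, which is arbitrarily small.
\<close>
lemma quadratic_form_of_indefinite_integral:
  fixes f x :: "real \<Rightarrow> real^'n" and Q :: "real^'n^'n"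
  assumes f: "f absolutely_integrable_on {0..T}"
    and x: "\<And>t. t \<in> {0..T} \<Longrightarrow> x t = integral {0..t} f"
    and Q: "transpose Q = Q" and t: "t \<in> {0..T}"
  shows "(\<lambda>s. (Q *v x s) \<bullet> f s) absolutely_integrable_on {0..T}" (is ?absint)
    and "x t \<bullet> (Q *v x t) = integral {0..t} (\<lambda>s. 2 * ((Q *v x s) \<bullet> f s))" (is ?eq)
proof -
  define y where "y s = Q *v x s" for s
  have f_int: "f integrable_on {0..T}" and nf_int: "(\<lambda>s. norm (f s)) integrable_on {0..T}"
    using f by (auto simp: absolutely_integrable_on_def)
  have "continuous_on {0..T} x"
    using continuous_on_cong[of "{0..T}" "{0..T}" x "\<lambda>t. integral {0..t} f"] x
      indefinite_integral_continuous_1[OF f_int] by simp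
  then have y_cont: "continuous_on {0..T} y"
    unfolding y_def by (rule bounded_linear.continuous_on[OF matrix_vector_mul_bounded_linear])
  have absint: "(\<lambda>s. y s \<bullet> f s) absolutely_integrable_on {0..T}"
    using y_cont f
    by (intro absolutely_integrable_bounded_measurable_product[where h="(\<bullet>)"] bilinear_conv_bounded_bilinear[THEN iffD2] bounded_bilinear_inner
        continuous_imp_measurable_on_sets_lebesgue compact_imp_bounded compact_continuous_image) auto
  then show ?absint by (simp add: y_def)
  then have h_int: "(\<lambda>s. 2 * (y s \<bullet> f s)) integrable_on {0..T}"
    using absint by (intro integrable_on_mult_right) (auto simp: absolutely_integrable_on_def)
  note sub = integrable_on_subinterval
  define D where "D s = x s \<bullet> y s - integral {0..s} (\<lambda>s. 2 * (y s \<bullet> f s))" for s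
  have D_diff: "\<bar>D b - D a\<bar> \<le> integral {a..b} (\<lambda>s. 2 * \<eta> * norm (f s))"
    if ab: "0 \<le> a" "a \<le> b" "b \<le> T"
      and \<eta>: "\<And>s s'. s \<in> {a..b} \<Longrightarrow> s' \<in> {a..b} \<Longrightarrow> norm (y s - y s') \<le> \<eta>" for a b \<eta>
  proof -
    have f_ab: "f integrable_on {a..b}" and nf_ab: "(\<lambda>s. norm (f s)) integrable_on {a..b}"
      and h_ab: "(\<lambda>s. 2 * (y s \<bullet> f s)) integrable_on {a..b}"
      and f_0b: "f integrable_on {0..b}" and h_0b: "(\<lambda>s. 2 * (y s \<bullet> f s)) integrable_on {0..b}"
      by (rule sub[OF f_int] sub[OF nf_int] sub[OF h_int]; use ab in simp)+
    have "x b - x a = integral {a..b} f"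
      using Henstock_Kurzweil_Integration.integral_combine[OF ab(1,2) f_0b] ab x[of a] x[of b] by (simp add: algebra_simps)
    moreover have "x b \<bullet> y b - x a \<bullet> y a = (y a + y b) \<bullet> (x b - x a)"
    proof -
      have "y a \<bullet> x b = y b \<bullet> x a"
        unfolding y_def using Q by (metis dot_lmul_matrix inner_commute transpose_matrix_vector)
      then show ?thesis by (simp add: algebra_simps inner_commute)
    qed
    ultimately have "x b \<bullet> y b - x a \<bullet> y a = integral {a..b} (\<lambda>s. (y a + y b) \<bullet> f s)"
      using integral_linear[OF f_ab bounded_linear_inner_right, of "y a + y b"] by (simp add: o_def)
    moreover have "integral {0..b} (\<lambda>s. 2 * (y s \<bullet> f s)) - integral {0..a} (\<lambda>s. 2 * (y s \<bullet> f s))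
        = integral {a..b} (\<lambda>s. 2 * (y s \<bullet> f s))"
      using Henstock_Kurzweil_Integration.integral_combine[OF ab(1,2) h_0b] by linarith
    moreover have l_ab: "(\<lambda>s. (y a + y b) \<bullet> f s) integrable_on {a..b}"
      using integrable_linear[OF f_ab bounded_linear_inner_right, of "y a + y b"] by (simp add: o_def)
    ultimately have "D b - D a = integral {a..b} (\<lambda>s. (y a + y b) \<bullet> f s - 2 * (y s \<bullet> f s))"
      unfolding D_def by (subst integral_diff[OF l_ab h_ab]) simp
    also have "norm \<dots> \<le> integral {a..b} (\<lambda>s. 2 * \<eta> * norm (f s))"
    proof (rule integral_norm_bound_integral)
      show "(\<lambda>s. (y a + y b) \<bullet> f s - 2 * (y s \<bullet> f s)) integrable_on {a..b}"
        by (rule integrable_diff[OF l_ab h_ab])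
      show "(\<lambda>s. 2 * \<eta> * norm (f s)) integrable_on {a..b}"
        by (rule integrable_on_mult_right[OF nf_ab])
      fix s assume s: "s \<in> {a..b}"
      have "(y a + y b) \<bullet> f s - 2 * (y s \<bullet> f s) = ((y a - y s) + (y b - y s)) \<bullet> f s"
        by (simp only: inner_add_left inner_diff_left)
      also have "norm \<dots> \<le> norm ((y a - y s) + (y b - y s)) * norm (f s)"
        by (simp add: Cauchy_Schwarz_ineq2)
      also have "\<dots> \<le> (\<eta> + \<eta>) * norm (f s)"
        using \<eta>[of a s] \<eta>[of b s] s by (intro mult_right_mono norm_triangle_mono) auto
      finally show "norm ((y a + y b) \<bullet> f s - 2 * (y s \<bullet> f s)) \<le> 2 * \<eta> * norm (f s)" by simp
    qed
    finally show ?thesis by simp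
  qed
  have small: "\<bar>D t\<bar> \<le> 2 * \<eta> * integral {0..t} (\<lambda>s. norm (f s))" if "\<eta> > 0" for \<eta>
  proof -
    have "uniformly_continuous_on {0..T} y"
      by (rule compact_uniformly_continuous[OF y_cont]) simp
    then obtain d where "d > 0" and d: "\<And>s s'. s \<in> {0..T} \<Longrightarrow> s' \<in> {0..T} \<Longrightarrow> dist s s' < d \<Longrightarrow> dist (y s) (y s') < \<eta>"
      using \<open>\<eta> > 0\<close> unfolding uniformly_continuous_on_def by metis
    obtain n :: nat where n: "t / d < real n" using reals_Archimedean2 by blast
    have "n > 0" using n t \<open>d > 0\<close> by (metis atLeastAtMost_iff divide_nonneg_pos gr0I not_le of_nat_0)
    define p where "p k = real k * t / real n" for k
    have p_step: "p (Suc k) - p k < d" "p k \<le> p (Suc k)" for k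
      using n t \<open>d > 0\<close> \<open>n > 0\<close> by (auto simp: p_def field_simps)
    have p_range: "0 \<le> p k" "k \<le> n \<Longrightarrow> p k \<le> t" for k
      using t \<open>n > 0\<close> by (auto simp: p_def field_simps intro: mult_left_mono)
    have g_int: "(\<lambda>s. 2 * \<eta> * norm (f s)) integrable_on {0..T}"
      by (rule integrable_on_mult_right[OF nf_int])
    have "\<bar>D (p k)\<bar> \<le> integral {0..p k} (\<lambda>s. 2 * \<eta> * norm (f s))" if "k \<le> n" for k
      using that
    proof (induction k)
      case 0
      then show ?case using x[of 0] t by (simp add: p_def D_def)
    next
      case (Suc k)
      have "\<bar>D (p (Suc k)) - D (p k)\<bar> \<le> integral {p k..p (Suc k)} (\<lambda>s. 2 * \<eta> * norm (f s))"
      proof (rule D_diff)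
        fix s s' assume "s \<in> {p k..p (Suc k)}" "s' \<in> {p k..p (Suc k)}"
        then have "dist s s' < d" and "s \<in> {0..T}" "s' \<in> {0..T}"
          using p_step[of k] p_range(1)[of k] p_range(2)[OF Suc.prems] t by (auto simp: dist_real_def)
        then show "norm (y s - y s') \<le> \<eta>"
          using d[of s s'] by (simp add: dist_norm)
      qed (use p_step[of k] p_range(1)[of k] p_range(2)[OF Suc.prems] t in auto)
      moreover have "integral {0..p k} (\<lambda>s. 2 * \<eta> * norm (f s)) + integral {p k..p (Suc k)} (\<lambda>s. 2 * \<eta> * norm (f s))
          = integral {0..p (Suc k)} (\<lambda>s. 2 * \<eta> * norm (f s))"
        using p_range(2)[OF Suc.prems] t
        by (intro Henstock_Kurzweil_Integration.integral_combine p_range(1) p_step(2) sub[OF g_int]) auto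
      ultimately show ?case using Suc by linarith
    qed
    from this[of n] \<open>n > 0\<close> show ?thesis by (simp add: p_def)
  qed
  have "D t = 0"
  proof (rule ccontr)
    assume "D t \<noteq> 0"
    define I where "I = integral {0..t} (\<lambda>s. norm (f s))"
    have "I \<ge> 0" unfolding I_def by (intro integral_nonneg sub[OF nf_int]) (use t in auto)
    \<comment> \<open>an \<open>\<eta>\<close> small enough that the bound falls below \<open>\<bar>D t\<bar>\<close>, whatever the size of \<open>I\<close>\<close>
    have "\<bar>D t\<bar> \<le> 2 * (\<bar>D t\<bar> / (4 * (I + 1))) * I"
      unfolding I_def by (rule small) (use \<open>D t \<noteq> 0\<close> \<open>I \<ge> 0\<close> in \<open>simp add: I_def\<close>)
    also have "\<dots> = \<bar>D t\<bar> * (I / (2 * (I + 1)))" using \<open>I \<ge> 0\<close> by (simp add: field_simps)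
    also have "\<dots> < \<bar>D t\<bar> * 1"
      using \<open>I \<ge> 0\<close> \<open>D t \<noteq> 0\<close> by (intro mult_strict_left_mono) (auto simp: field_simps)
    finally show False by simp
  qed
  then show ?eq by (simp add: D_def y_def)
qed

lemma
  fixes A Q :: "real^'n^'n" and B :: "real^'w^'n"
  assumes traj: "zero_state_trajectory A B w x" and Q: "transpose Q = Q"
  shows trajectory_continuous: "continuous_on {0..} x"
    and storage_rate_absolutely_integrable:
      "0 \<le> t \<Longrightarrow> (\<lambda>s. (Q *v x s) \<bullet> (A *v x s + B *v w s)) absolutely_integrable_on {0..t}"
    and storage_eq_integral:
      "0 \<le> t \<Longrightarrow> x t \<bullet> (Q *v x t) = integral {0..t} (\<lambda>s. 2 * ((Q *v x s) \<bullet> (A *v x s + B *v w s)))"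
proof -
  let ?f = "\<lambda>s. A *v x s + B *v w s"
  have absint: "?f absolutely_integrable_on {0..t}" and x: "x t = integral {0..t} ?f" if "0 \<le> t" for t
    using traj that by (auto simp: zero_state_trajectory_def)
  show "(\<lambda>s. (Q *v x s) \<bullet> ?f s) absolutely_integrable_on {0..t}"
    and "x t \<bullet> (Q *v x t) = integral {0..t} (\<lambda>s. 2 * ((Q *v x s) \<bullet> ?f s))" if "0 \<le> t"
    using quadratic_form_of_indefinite_integral[OF absint[OF that] x Q, of t] that by auto
  have cont: "continuous_on {0..T} x" if "0 \<le> T" for T
  proof -
    have "?f integrable_on {0..T}" using absint[OF that] by (simp add: absolutely_integrable_on_def)
    from indefinite_integral_continuous_1[OF this] show ?thesis
      using continuous_on_cong[of "{0..T}" "{0..T}" x "\<lambda>t. integral {0..t} ?f"] x by simp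
  qed
  show "continuous_on {0..} x"
    unfolding continuous_on_eq_continuous_within
  proof
    fix t :: real assume "t \<in> {0..}"
    then have "continuous (at t within {0..t+1}) x"
      using cont[of "t+1"] by (auto simp: continuous_on_eq_continuous_within)
    moreover have "at t within {0..} = at t within {0..t+1}"
      by (rule at_within_nhd[of _ "{..<t+1}"]) auto
    ultimately show "continuous (at t within {0..}) x" by simp
  qed
qed

text \<open>
  If \<open>V\<close> were above \<open>c\<close> at time \<open>t\<close>, there would be a last earlier time \<open>r\<close> with \<open>V r \<le> c\<close>. On
  \<open>(r, t]\<close> the rate of \<open>V\<close> is at most \<open>\<alpha> (c - V) \<le> 0\<close>, so \<open>V t \<le> V r \<le> c\<close>.
\<close>
lemma storage_bounded:
  fixes A Q :: "real^'n^'n" and B :: "real^'w^'n"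
  assumes traj: "zero_state_trajectory A B w x" and Q: "transpose Q = Q" and "\<alpha> > 0"
    and dissipation: "\<And>x w. 2 * ((Q *v x) \<bullet> (A *v x + B *v w)) \<le> \<alpha> * ((norm w)\<^sup>2 - x \<bullet> (Q *v x))"
    and w: "\<And>t. t \<ge> 0 \<Longrightarrow> (norm (w t))\<^sup>2 \<le> c" and "t \<ge> 0"
  shows "x t \<bullet> (Q *v x t) \<le> c"
proof (rule ccontr)
  assume above: "\<not> x t \<bullet> (Q *v x t) \<le> c"
  define V where "V s = x s \<bullet> (Q *v x s)" for s
  define h where "h = (\<lambda>s. 2 * ((Q *v x s) \<bullet> (A *v x s + B *v w s)))"
  have V_eq: "V s = integral {0..s} h" if "s \<ge> 0" for s
    unfolding V_def h_def using storage_eq_integral[OF traj Q that] .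
  have h_int: "h integrable_on {0..t}"
    using storage_rate_absolutely_integrable[OF traj Q \<open>t \<ge> 0\<close>] unfolding h_def
    by (intro integrable_on_mult_right) (auto simp: absolutely_integrable_on_def)
  have "c \<ge> 0" using w[of 0] by (meson order_refl order_trans zero_le_power2)
  have "continuous_on {0..t} V"
    unfolding V_def using continuous_on_subset[OF trajectory_continuous[OF traj Q], of "{0..t}"]
    by (intro continuous_on_inner bounded_linear.continuous_on[OF matrix_vector_mul_bounded_linear]) auto
  then have "closed {s \<in> {0..t}. V s \<le> c}"
    by (intro continuous_on_closed_Collect_le continuous_on_const) auto
  moreover have "0 \<in> {s \<in> {0..t}. V s \<le> c}" 
    using V_eq[of 0] \<open>c \<ge> 0\<close> \<open>t \<ge> 0\<close> by simp
  moreover have bdd: "bdd_above {s \<in> {0..t}. V s \<le> c}" by (rule bdd_above_mono[of "{0..t}"]) auto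
  ultimately have "Sup {s \<in> {0..t}. V s \<le> c} \<in> {s \<in> {0..t}. V s \<le> c}"
    by (intro closed_contains_Sup) auto
  then obtain r where r: "0 \<le> r" "r \<le> t" "V r \<le> c" and r_Sup: "r = Sup {s \<in> {0..t}. V s \<le> c}"
    by auto
  have beyond: "V s > c" if "s \<in> {r<..t}" for s
    using cSup_upper[OF _ bdd, of s] that r unfolding r_Sup[symmetric] by force
  have "V t - V r = integral {r..t} h"
    using Henstock_Kurzweil_Integration.integral_combine[OF r(1,2) h_int] V_eq[of r] V_eq[of t] r by linarith
  also have "\<dots> = integral {r<..t} h"
    by (rule integral_spike_set) (auto intro: negligible_subset[of "{r}"])
  also have "\<dots> \<le> integral {r<..t} (\<lambda>s. 0)"
  proof (rule integral_le)
    have "h integrable_on {r..t}" using r by (auto intro: integrable_on_subinterval[OF h_int])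
    then show "h integrable_on {r<..t}"
      by (rule integrable_spike_set) (auto intro: negligible_subset[of "{r}"])
    fix s assume s: "s \<in> {r<..t}"
    have "h s \<le> \<alpha> * ((norm (w s))\<^sup>2 - V s)"
      unfolding h_def V_def by (rule dissipation)
    also have "\<dots> \<le> 0"
      using w[of s] beyond[OF s] r s \<open>\<alpha> > 0\<close> by (intro mult_nonneg_nonpos) auto
    finally show "h s \<le> 0" .
  qed (rule integrable_0)
  finally show False using r above by (simp add: V_def)
qed

section \<open>The \<open>L\<^sub>2\<close> gain\<close>

lemma nn_integral_halfline_le:
  fixes g :: "real \<Rightarrow> ennreal"
  assumes g: "g \<in> borel_measurable (lebesgue_on {0..})"
    and le: "\<And>n::nat. (\<integral>\<^sup>+ t. g t \<partial>lebesgue_on {0..real n}) \<le> c"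
  shows "(\<integral>\<^sup>+ t. g t \<partial>lebesgue_on {0..}) \<le> c"
proof -
  have restrict: "(\<integral>\<^sup>+ t. g t * indicator {0..real n} t \<partial>lebesgue_on {0..}) = (\<integral>\<^sup>+ t. g t \<partial>lebesgue_on {0..real n})" for n
    by (auto simp: nn_integral_restrict_space intro!: nn_integral_cong split: split_indicator)
  have "g t = (SUP n. g t * indicator {0..real n} t)" if "t \<ge> 0" for t
  proof (rule antisym)
    obtain n :: nat where "t \<le> real n" using real_arch_simple by blast
    then show "g t \<le> (SUP n. g t * indicator {0..real n} t)"
      using that by (intro SUP_upper2[of n]) auto
  qed (auto intro!: SUP_least split: split_indicator)
  then have "(\<integral>\<^sup>+ t. g t \<partial>lebesgue_on {0..}) = (\<integral>\<^sup>+ t. (SUP n. g t * indicator {0..real n} t) \<partial>lebesgue_on {0..})"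
    by (intro nn_integral_cong) auto
  also have "\<dots> = (SUP n. \<integral>\<^sup>+ t. g t * indicator {0..real n} t \<partial>lebesgue_on {0..})"
  proof (rule nn_integral_monotone_convergence_SUP)
    show "incseq (\<lambda>n t. g t * indicator {0..real n} t)"
      by (auto simp: incseq_def le_fun_def split: split_indicator)
    show "(\<lambda>t. g t * indicator {0..real n} t) \<in> borel_measurable (lebesgue_on {0..})" for n
      by (intro borel_measurable_times_ennreal g borel_measurable_indicator) (auto simp: sets_restrict_space)
  qed
  also have "\<dots> \<le> c" unfolding restrict by (intro SUP_least le)
  finally show ?thesis .
qed

lemma nn_integral_eq_integral_interval:
  fixes h :: "real \<Rightarrow> real"
  assumes "h integrable_on S" "\<And>t. t \<in> S \<Longrightarrow> h t \<ge> 0" "S \<in> sets lebesgue"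
  shows "(\<integral>\<^sup>+ t. ennreal (h t) \<partial>lebesgue_on S) = ennreal (integral S h)"
proof -
  have "h absolutely_integrable_on S"
    using assms by (intro nonnegative_absolutely_integrable_1) auto
  then have "integrable (lebesgue_on S) h"
    using assms by (simp add: integrable_restrict_space set_integrable_def)
  then show ?thesis
    using assms by (subst nn_integral_eq_integral) (auto simp: lebesgue_integral_eq_integral)
qed

text \<open>
  Integrating the dissipation inequality over \<open>[0, n]\<close> gives
  \<open>\<gamma> V(x(n)) + \<integral> |z|\<^sup>2 \<le> c\<^sup>2 \<integral> |w|\<^sup>2\<close>; the storage term is nonnegative and can be dropped before
  \<open>n\<close> tends to infinity.
\<close>
lemma L2_gain_le:
  fixes A Q :: "real^'n^'n" and B :: "real^'w^'n" and C :: "real^'n^'z" and D :: "real^'w^'z"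
  assumes Q: "positive_definite Q" and "c \<ge> 0" "\<gamma> > 0"
    and dissipation: "\<And>x w. \<gamma> * (2 * ((Q *v x) \<bullet> (A *v x + B *v w))) + (norm (C *v x + D *v w))\<^sup>2 \<le> c\<^sup>2 * (norm w)\<^sup>2"
  shows "L2_gain A B C D \<le> ennreal c"
  unfolding L2_gain_def
proof (rule SUP_least, clarify)
  fix w x assume traj: "zero_state_trajectory A B w x" and pos: "0 < L2_norm w" and fin: "L2_norm w < \<infinity>"
  define z where "z t = C *v x t + D *v w t" for t
  have sym: "transpose Q = Q" using Q by (simp add: positive_definite_def)
  have w_meas: "w \<in> borel_measurable (lebesgue_on {0..})"
    using traj by (simp add: zero_state_trajectory_def)
  have x_meas: "x \<in> borel_measurable (lebesgue_on {0..})"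
    by (intro continuous_imp_measurable_on_sets_lebesgue trajectory_continuous[OF traj sym]) auto
  have "(*v) C \<in> borel_measurable borel" "(*v) D \<in> borel_measurable borel"
    by (intro borel_measurable_continuous_onI linear_continuous_on matrix_vector_mul_bounded_linear)+
  from measurable_compose[OF x_meas this(1)] measurable_compose[OF w_meas this(2)]
  have z_meas: "z \<in> borel_measurable (lebesgue_on {0..})"
    unfolding z_def by (intro borel_measurable_add)
  define Ew where "Ew = (\<integral>\<^sup>+ t. ennreal ((norm (w t))\<^sup>2) \<partial>lebesgue_on {0..})"
  define Ez where "Ez = (\<integral>\<^sup>+ t. ennreal ((norm (z t))\<^sup>2) \<partial>lebesgue_on {0..})"
  have "Ew < \<infinity>" using fin by (auto simp: L2_norm_def Ew_def Let_def less_top split: if_splits)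
  then have "integrable (lebesgue_on {0..}) (\<lambda>t. (norm (w t))\<^sup>2)"
    using w_meas unfolding Ew_def by (intro integrableI_nonneg) auto
  then have w_int: "(\<lambda>t. (norm (w t))\<^sup>2) integrable_on {0..}"
    by (metis has_integral_integral_lebesgue_on integrable_on_def atLeast_borel sets_completionI_sets sets_lborel)
  define W where "W = integral {0..} (\<lambda>t. (norm (w t))\<^sup>2)"
  have "W \<ge> 0" unfolding W_def by (intro integral_nonneg w_int) auto
  have Ew: "Ew = ennreal W"
    unfolding Ew_def W_def by (intro nn_integral_eq_integral_interval w_int) auto
  have "Ez \<le> ennreal (c\<^sup>2 * W)"
    unfolding Ez_def
  proof (rule nn_integral_halfline_le)
    show "(\<lambda>t. ennreal ((norm (z t))\<^sup>2)) \<in> borel_measurable (lebesgue_on {0..})"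
      using z_meas by measurable
    fix n :: nat
    define r where "r = (\<lambda>t. 2 * ((Q *v x t) \<bullet> (A *v x t + B *v w t)))"
    \<comment> \<open>an integrable majorant of \<open>|z|\<^sup>2\<close>\<close>
    define h where "h = (\<lambda>t. c\<^sup>2 * (norm (w t))\<^sup>2 - \<gamma> * r t)"
    have r_int: "r integrable_on {0..real n}"
      using storage_rate_absolutely_integrable[OF traj sym, of "real n"] unfolding r_def
      by (intro integrable_on_mult_right) (auto simp: absolutely_integrable_on_def)
    have w_int_n: "(\<lambda>t. (norm (w t))\<^sup>2) integrable_on {0..real n}"
      by (rule integrable_on_subinterval[OF w_int]) auto
    have h_int: "h integrable_on {0..real n}"
      unfolding h_def by (intro integrable_diff integrable_on_mult_right r_int w_int_n)
    have h: "(norm (z t))\<^sup>2 \<le> h t" for t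
      using dissipation[of "x t" "w t"] by (simp add: h_def r_def z_def)
    have "integral {0..real n} h = c\<^sup>2 * integral {0..real n} (\<lambda>t. (norm (w t))\<^sup>2) - \<gamma> * integral {0..real n} r"
      unfolding h_def
      by (subst integral_diff) (auto intro: integrable_on_mult_right r_int w_int_n simp del: integral_mult_right simp: integral_mult_right[symmetric])
    also have "integral {0..real n} r = x n \<bullet> (Q *v x n)"
      unfolding r_def using storage_eq_integral[OF traj sym, of "real n"] by simp
    also have "c\<^sup>2 * integral {0..real n} (\<lambda>t. (norm (w t))\<^sup>2) - \<gamma> * (x n \<bullet> (Q *v x n)) \<le> c\<^sup>2 * W - 0"
    proof (rule diff_mono)
      show "c\<^sup>2 * integral {0..real n} (\<lambda>t. (norm (w t))\<^sup>2) \<le> c\<^sup>2 * W"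
        unfolding W_def by (intro mult_left_mono integral_subset_le w_int w_int_n) auto
      show "0 \<le> \<gamma> * (x n \<bullet> (Q *v x n))"
        using \<open>\<gamma> > 0\<close> positive_definite_nonneg[OF Q] by simp
    qed
    finally have "integral {0..real n} h \<le> c\<^sup>2 * W" by simp
    have "(\<integral>\<^sup>+ t. ennreal ((norm (z t))\<^sup>2) \<partial>lebesgue_on {0..real n}) \<le> (\<integral>\<^sup>+ t. ennreal (h t) \<partial>lebesgue_on {0..real n})"
      by (intro nn_integral_mono ennreal_leI h)
    also have "\<dots> = ennreal (integral {0..real n} h)"
      by (intro nn_integral_eq_integral_interval h_int order_trans[OF zero_le_power2 h]) auto
    also have "\<dots> \<le> ennreal (c\<^sup>2 * W)" by (intro ennreal_leI) fact
    finally show "(\<integral>\<^sup>+ t. ennreal ((norm (z t))\<^sup>2) \<partial>lebesgue_on {0..real n}) \<le> ennreal (c\<^sup>2 * W)" .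
  qed
  then have "Ez < \<infinity>" and "enn2real Ez \<le> c\<^sup>2 * W"
    using \<open>W \<ge> 0\<close> by (auto simp: enn2real_leI intro: le_less_trans)
  then have "L2_norm z \<le> ennreal (sqrt (c\<^sup>2 * W))"
    unfolding L2_norm_def Ez_def[symmetric] by (auto intro!: ennreal_leI)
  also have "\<dots> = ennreal c * L2_norm w"
    unfolding L2_norm_def Ew_def[symmetric] Ew using \<open>c \<ge> 0\<close> \<open>W \<ge> 0\<close>
    by (simp add: real_sqrt_mult ennreal_mult)
  finally have "L2_norm z \<le> ennreal c * L2_norm w" .
  then show "L2_norm (\<lambda>t. C *v x t + D *v w t) / L2_norm w \<le> ennreal c"
    unfolding z_def[abs_def] using pos fin by (intro divide_le_posI_ennreal) (auto simp: mult.commute)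
qed

section \<open>Stability and the transfer function\<close>

definition Re_vec :: "complex^'n \<Rightarrow> real^'n" where
  "Re_vec v = (\<chi> i. Re (v $ i))"

definition Im_vec :: "complex^'n \<Rightarrow> real^'n" where
  "Im_vec v = (\<chi> i. Im (v $ i))"

lemma Re_Im_vec_eq_0_iff: "Re_vec v = 0 \<and> Im_vec v = 0 \<longleftrightarrow> v = 0"
  by (auto simp: Re_vec_def Im_vec_def vec_eq_iff complex_eq_iff)

lemma Re_Im_vec_add:
  "Re_vec (u + v) = Re_vec u + Re_vec v" "Im_vec (u + v) = Im_vec u + Im_vec v"
  by (simp_all add: Re_vec_def Im_vec_def vec_eq_iff)

lemma Re_Im_vec_complex_matrix:
  "Re_vec (complex_matrix M *v v) = M *v Re_vec v" "Im_vec (complex_matrix M *v v) = M *v Im_vec v"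
  by (simp_all add: Re_vec_def Im_vec_def vec_eq_iff complex_matrix_def matrix_vector_mult_def)

lemma Re_Im_vec_scale:
  "Re_vec (s *s v) = Re s *\<^sub>R Re_vec v - Im s *\<^sub>R Im_vec v"
  "Im_vec (s *s v) = Im s *\<^sub>R Re_vec v + Re s *\<^sub>R Im_vec v"
  by (simp_all add: Re_vec_def Im_vec_def vec_eq_iff)

lemma norm_Re_Im_vec: "(norm v)\<^sup>2 = (norm (Re_vec v))\<^sup>2 + (norm (Im_vec v))\<^sup>2"
  by (simp add: norm_vec_def L2_set_def Re_vec_def Im_vec_def sum_nonneg cmod_power2 sum.distrib)

text \<open>
  For a complex state with \<open>x' = s x\<close> the terms \<open>(Q x) \<bullet> x'\<close> of the real and the imaginary part, half
  their storage rates, add up to \<open>Re s\<close> times the total storage: the cross terms with \<open>Im s\<close> cancel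
  by symmetry of \<open>Q\<close>.
\<close>
lemma storage_rate_Re_Im:
  fixes Q :: "real^'n^'n"
  assumes "transpose Q = Q"
  shows "(Q *v Re_vec v) \<bullet> Re_vec (s *s v) + (Q *v Im_vec v) \<bullet> Im_vec (s *s v)
    = Re s * (Re_vec v \<bullet> (Q *v Re_vec v) + Im_vec v \<bullet> (Q *v Im_vec v))"
proof -
  have "(Q *v Re_vec v) \<bullet> Im_vec v = (Q *v Im_vec v) \<bullet> Re_vec v"
    using assms by (metis dot_lmul_matrix inner_commute transpose_matrix_vector)
  then show ?thesis
    by (simp add: Re_Im_vec_scale inner_diff_right inner_add_right algebra_simps inner_commute)
qed

text \<open>
  For an eigenvector the left side of \<open>storage_rate_Re_Im\<close> is negative by \<open>dec\<close>, and the right side is \<open>Re s\<close> times a nonnegative number.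
\<close>
lemma stable_if_lyapunov:
  fixes M Q :: "real^'n^'n"
  assumes Q: "positive_definite Q"
    and dec: "\<And>x. x \<noteq> 0 \<Longrightarrow> (Q *v x) \<bullet> (M *v x) < 0"
  shows "hurwitz M"
  unfolding hurwitz_def
proof (intro allI impI, elim conjE)
  fix s :: complex and v :: "complex^'n"
  assume "v \<noteq> 0" and eig: "complex_matrix M *v v = s *s v"
  have "(Q *v Re_vec v) \<bullet> (M *v Re_vec v) + (Q *v Im_vec v) \<bullet> (M *v Im_vec v) < 0"
    using \<open>v \<noteq> 0\<close> dec[of "Re_vec v"] dec[of "Im_vec v"] Re_Im_vec_eq_0_iff[of v]
    by (cases "Re_vec v = 0"; cases "Im_vec v = 0") auto
  then have "Re s * (Re_vec v \<bullet> (Q *v Re_vec v) + Im_vec v \<bullet> (Q *v Im_vec v)) < 0"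
    using Q storage_rate_Re_Im[of Q v s]
    by (simp add: positive_definite_def eig[symmetric] Re_Im_vec_complex_matrix)
  moreover have "Re_vec v \<bullet> (Q *v Re_vec v) + Im_vec v \<bullet> (Q *v Im_vec v) \<ge> 0"
    by (intro add_nonneg_nonneg positive_definite_nonneg Q)
  ultimately show "Re s < 0" by (meson mult_nonneg_nonneg not_less)
qed

text \<open>
  A kernel vector of \<open>s I - A\<close> would be an eigenvector of \<open>A\<close> for \<open>s\<close> in the right half plane, so for
  Hurwitz \<open>A\<close> the matrix inverse in the transfer function is a genuine one.
\<close>
lemma resolvent_equation:
  fixes A :: "real^'n^'n" and v :: "complex^'n"
  assumes "hurwitz A" "Re s > 0"
  defines "x \<equiv> matrix_inv (mat s - complex_matrix A) *v v"
  shows "s *s x = complex_matrix A *v x + v"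
proof -
  let ?N = "mat s - complex_matrix A"
  have scale: "mat s *v y = s *s y" for y :: "complex^'n"
    by (simp add: mat_def matrix_vector_mult_def vec_eq_iff if_distrib[of "\<lambda>a. a * _"] cong: if_cong)
  have "y = 0" if "?N *v y = 0" for y
    using that assms unfolding hurwitz_def
    by (metis matrix_vector_mult_diff_rdistrib right_minus_eq scale not_less_iff_gr_or_eq)
  then have "invertible ?N"
    by (simp add: invertible_left_inverse matrix_left_invertible_ker)
  then have "?N *v x = v"
    by (simp add: x_def matrix_vector_mul_assoc matrix_inv_right)
  then show ?thesis by (simp add: matrix_vector_mult_diff_rdistrib scale algebra_simps)
qed

text \<open>
  The frequency domain counterpart of \<open>L2_gain_le\<close>: with \<open>x = (s I - A)\<^sup>-\<^sup>1 B w\<close> the real and the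
  imaginary parts of \<open>(x, w)\<close> each satisfy the dissipation inequality, and the sum of their storage
  rates is nonnegative because \<open>Re s > 0\<close>.
\<close>
lemma Hinf_norm_le:
  fixes A Q :: "real^'n^'n" and B :: "real^'w^'n" and C :: "real^'n^'z" and D :: "real^'w^'z"
  assumes Q: "positive_definite Q" and "hurwitz A" and "c \<ge> 0" "\<gamma> > 0"
    and dissipation: "\<And>x w. \<gamma> * (2 * ((Q *v x) \<bullet> (A *v x + B *v w))) + (norm (C *v x + D *v w))\<^sup>2 \<le> c\<^sup>2 * (norm w)\<^sup>2"
  shows "Hinf_norm (transfer_function A B C D) \<le> ennreal c"
  unfolding Hinf_norm_def
proof (intro SUP_least ennreal_leI onorm_le)
  fix s :: complex and w :: "complex^'w"
  assume "s \<in> {s. Re s > 0}"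
  then have s: "Re s > 0" by simp
  define x where "x = matrix_inv (mat s - complex_matrix A) *v (complex_matrix B *v w)"
  define z where "z = complex_matrix C *v x + complex_matrix D *v w"
  have Tz: "transfer_function A B C D s *v w = z"
    by (simp add: transfer_function_def z_def x_def matrix_vector_mult_add_rdistrib matrix_vector_mul_assoc matrix_mul_assoc)
  have x: "s *s x = complex_matrix A *v x + complex_matrix B *v w"
    unfolding x_def by (rule resolvent_equation) fact+
  have "0 \<le> \<gamma> * (2 * (Re s * (Re_vec x \<bullet> (Q *v Re_vec x) + Im_vec x \<bullet> (Q *v Im_vec x))))"
    using s \<open>\<gamma> > 0\<close> by (intro mult_nonneg_nonneg add_nonneg_nonneg positive_definite_nonneg Q) auto
  also have "\<dots> = \<gamma> * (2 * ((Q *v Re_vec x) \<bullet> (A *v Re_vec x + B *v Re_vec w)))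
      + \<gamma> * (2 * ((Q *v Im_vec x) \<bullet> (A *v Im_vec x + B *v Im_vec w)))"
    using Q storage_rate_Re_Im[of Q x s]
    by (simp add: positive_definite_def x Re_Im_vec_add Re_Im_vec_complex_matrix flip: distrib_left)
  finally have "(norm z)\<^sup>2 \<le> c\<^sup>2 * (norm w)\<^sup>2"
    using dissipation[of "Re_vec x" "Re_vec w"] dissipation[of "Im_vec x" "Im_vec w"]
    unfolding norm_Re_Im_vec[of z] norm_Re_Im_vec[of w]
    by (simp add: z_def Re_Im_vec_add Re_Im_vec_complex_matrix distrib_left)
  then show "norm (transfer_function A B C D s *v w) \<le> c * norm w"
    unfolding Tz using \<open>c \<ge> 0\<close> by (auto simp: power_mult_distrib intro: power2_le_imp_le[of _ "c * norm w"])
qed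

text \<open>
  Multiplied by \<open>\<gamma>\<close>, the inequality bounds both gains by \<open>sqrt (\<gamma> (\<gamma> - \<delta>)) < \<gamma>\<close>.
\<close>
lemma attenuation_from_strict_dissipation:
  fixes A Q :: "real^'n^'n" and B :: "real^'w^'n" and C :: "real^'n^'z" and D :: "real^'w^'z"
  assumes Q: "positive_definite Q" and "hurwitz A" and "\<gamma> > 0" "\<delta> > 0"
    and dissipation: "\<And>x w. 2 * ((Q *v x) \<bullet> (A *v x + B *v w)) + (norm (C *v x + D *v w))\<^sup>2 / \<gamma>
        \<le> (\<gamma> - \<delta>) * (norm w)\<^sup>2"
  shows "disturbance_attenuation_level A B C D \<gamma>"
proof -
  \<comment> \<open>\<open>min \<delta> \<gamma>\<close> instead of \<open>\<delta>\<close> keeps the radicand nonnegative\<close>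
  define c where "c = sqrt (\<gamma> * (\<gamma> - min \<delta> \<gamma>))"
  have c2: "c\<^sup>2 = \<gamma> * (\<gamma> - min \<delta> \<gamma>)"
    unfolding c_def using \<open>\<gamma> > 0\<close> by (intro real_sqrt_pow2 mult_nonneg_nonneg) auto
  have "c \<ge> 0" unfolding c_def using \<open>\<gamma> > 0\<close> by auto
  have "\<gamma> * (\<gamma> - min \<delta> \<gamma>) < \<gamma> * \<gamma>"
    using \<open>\<gamma> > 0\<close> \<open>\<delta> > 0\<close> by (intro mult_strict_left_mono) auto
  then have "c\<^sup>2 < \<gamma>\<^sup>2" by (simp only: c2 power2_eq_square[of \<gamma>])
  then have "c < \<gamma>" using \<open>\<gamma> > 0\<close> by (rule power2_less_imp_less[OF _ less_imp_le])
  have diss: "\<gamma> * (2 * ((Q *v x) \<bullet> (A *v x + B *v w))) + (norm (C *v x + D *v w))\<^sup>2 \<le> c\<^sup>2 * (norm w)\<^sup>2" for x w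
  proof -
    have "\<gamma> * (2 * ((Q *v x) \<bullet> (A *v x + B *v w))) + (norm (C *v x + D *v w))\<^sup>2
        \<le> \<gamma> * ((\<gamma> - \<delta>) * (norm w)\<^sup>2)"
      using mult_left_mono[OF dissipation[of x w], of \<gamma>] \<open>\<gamma> > 0\<close> by (simp add: distrib_left)
    also have "\<dots> \<le> \<gamma> * ((\<gamma> - min \<delta> \<gamma>) * (norm w)\<^sup>2)"
      using \<open>\<gamma> > 0\<close> by (intro mult_left_mono mult_right_mono) auto
    finally show ?thesis by (simp add: c2 mult.assoc)
  qed
  have "ennreal c < ennreal \<gamma>" using \<open>c < \<gamma>\<close> \<open>c \<ge> 0\<close> by (simp add: ennreal_lessI)
  then show ?thesis
    unfolding disturbance_attenuation_level_def
    using L2_gain_le[OF Q \<open>c \<ge> 0\<close> \<open>\<gamma> > 0\<close> diss] Hinf_norm_le[OF Q \<open>hurwitz A\<close> \<open>c \<ge> 0\<close> \<open>\<gamma> > 0\<close> diss]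
    by (auto intro: le_less_trans)
qed

section \<open>The synthesis theorem\<close>

lemma matrix_mult_add_rdistrib:
  fixes L M :: "'a::semiring_1^'n^'m"
  shows "(L + M) ** N = L ** N + M ** N"
  by (simp add: matrix_matrix_mult_def vec_eq_iff distrib_right sum.distrib)

theorem lemma4:
  fixes A :: "real^'n^'n" and B1 :: "real^'w^'n" and B2 :: "real^'u^'n"
    and C1 :: "real^'n^'z" and D11 :: "real^'w^'z" and D12 :: "real^'u^'z"
    and w_max u_lim :: real
    and X1 X2 G P :: "real^'n^'n" and Y K :: "real^'n^'u"
    and \<alpha>_new \<gamma>_new \<epsilon>1 \<epsilon>2 \<epsilon>3 :: real
  assumes "w_max > 0" and "u_lim > 0"
    and "positive_definite X1" and "positive_definite X2"
    and "\<alpha>_new > 0"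
    and "0 < \<epsilon>1" "\<epsilon>1 < 1" and "0 < \<epsilon>2" "\<epsilon>2 < 1" and "0 < \<epsilon>3" "\<epsilon>3 < 1"
    and "P = A ** G + B2 ** Y - (1/2) *\<^sub>R G"
    and "negative_definite (sym_block4
           (X1 + P + transpose P)  B1
             (transpose G ** transpose C1 + transpose Y ** transpose D12)
             (- X1 + transpose G - (2 * \<epsilon>1) *\<^sub>R P)
           ((- \<gamma>_new) *\<^sub>R mat 1)  (transpose D11)  0
           ((- \<gamma>_new) *\<^sub>R mat 1)  ((- 2 * \<epsilon>1) *\<^sub>R (C1 ** G + D12 ** Y))
           ((- 2 * \<epsilon>1) *\<^sub>R (transpose G + G)))"
    and "negative_definite (sym_block3
           (X2 + P + transpose P + (\<alpha>_new / 2) *\<^sub>R (G + transpose G))  B1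
             (- X2 + transpose G - (2 * \<epsilon>2) *\<^sub>R (P + (\<alpha>_new / 2) *\<^sub>R G))
           ((- \<alpha>_new) *\<^sub>R mat 1)  0
           ((- 2 * \<epsilon>2) *\<^sub>R (transpose G + G)))"
    and "negative_definite (sym_block3
           (X2 - G - transpose G)  (- transpose Y)
             (- X2 + transpose G + (2 * \<epsilon>3) *\<^sub>R G)
           ((- (u_lim\<^sup>2 / w_max\<^sup>2)) *\<^sub>R mat 1)  ((2 * \<epsilon>3) *\<^sub>R Y)
           ((- 2 * \<epsilon>3) *\<^sub>R (transpose G + G)))"
    and "K = Y ** matrix_inv G"
  shows "hurwitz (A + B2 ** K) \<and>
         never_saturates (A + B2 ** K) B1 K w_max u_lim \<and>
         disturbance_attenuation_level (A + B2 ** K) B1 (C1 + D12 ** K) D11 \<gamma>_new"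
proof -
  note lmi1 = assms(13) and lmi2 = assms(14) and lmi3 = assms(15)
  let ?A = "A + B2 ** K" and ?C = "C1 + D12 ** K" and ?c = "u_lim\<^sup>2 / w_max\<^sup>2"
  \<comment> \<open>the last diagonal block of any of the three inequalities forces \<open>G\<^sup>T + G\<close> to be positive definite\<close>
  have "invertible G"
  proof (rule invertible_if_symmetric_part_positive)
    fix v :: "real^'n" assume "v \<noteq> 0"
    then have "stack (0::real^'n) (stack (0::real^'u) v) \<noteq> 0" by (simp add: stack_eq_0_iff)
    with lmi3 have "v \<bullet> (((- 2 * \<epsilon>3) *\<^sub>R (transpose G + G)) *v v) < 0"
      unfolding negative_definite_def by (fastforce simp: inner_sym_block3)
    then have "(- 2 * \<epsilon>3) * (v \<bullet> ((transpose G + G) *v v)) < 0"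
      by (simp only: scaleR_matrix_vector_assoc[symmetric] inner_scaleR_right)
    then show "v \<bullet> ((transpose G + G) *v v) > 0"
      using \<open>0 < \<epsilon>3\<close> by (simp add: zero_less_mult_iff del: transpose_matrix_vector)
  qed
  have matrix_inv_left: "matrix_inv G ** G = mat 1"
    using matrix_inv_right[OF \<open>invertible G\<close>] by (simp add: matrix_left_right_inverse)
  then have Y: "Y = K ** G"
    using assms(16) by (simp add: matrix_mul_assoc[symmetric])
  have P: "P = ?A ** G - (1/2) *\<^sub>R G"
    using assms(12) by (simp add: Y matrix_mult_add_rdistrib matrix_mul_assoc)
  have CG: "C1 ** G + D12 ** Y = ?C ** G"
    by (simp add: Y matrix_mult_add_rdistrib matrix_mul_assoc)
  have "transpose G ** transpose C1 + transpose Y ** transpose D12 = transpose (C1 ** G + D12 ** Y)"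
    by (simp only: matrix_transpose_mul[symmetric]) (simp add: transpose_def vec_eq_iff)
  then have CGT: "transpose G ** transpose C1 + transpose Y ** transpose D12 = transpose G ** transpose ?C"
    by (simp add: CG matrix_transpose_mul)
  obtain Q1 \<delta> where Q1: "positive_definite Q1" and "\<delta> > 0" "\<gamma>_new > 0"
    and lyap: "\<And>x. x \<noteq> 0 \<Longrightarrow> (Q1 *v x) \<bullet> (?A *v x) < 0"
    and diss: "\<And>x w. 2 * ((Q1 *v x) \<bullet> (?A *v x + B1 *v w)) + (norm (?C *v x + D11 *v w))\<^sup>2 / \<gamma>_new
        \<le> (\<gamma>_new - \<delta>) * (norm w)\<^sup>2"
    using bounded_real_LMI[OF \<open>positive_definite X1\<close> P lmi1[unfolded CGT CG]] by blast
  have "hurwitz ?A" by (rule stable_if_lyapunov[OF Q1 lyap])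
  moreover have "never_saturates ?A B1 K w_max u_lim"
  proof -
    obtain Q2 where Q2: "positive_definite Q2" and XQ2: "\<And>x. X2 *v (Q2 *v x) = x"
      using positive_definite_inverse[OF \<open>positive_definite X2\<close>] by blast
    have "norm (K *v x t) \<le> u_lim"
      if traj: "zero_state_trajectory ?A B1 w x" and w: "\<forall>t\<ge>0. w t \<bullet> w t \<le> w_max\<^sup>2" and "t \<ge> 0" for w x t
    proof -
      have "x t \<bullet> (Q2 *v x t) \<le> w_max\<^sup>2"
      proof (rule storage_bounded[OF traj _ \<open>\<alpha>_new > 0\<close>])
        show "transpose Q2 = Q2" using Q2 by (simp add: positive_definite_def)
        show "2 * ((Q2 *v x) \<bullet> (?A *v x + B1 *v w)) \<le> \<alpha>_new * ((norm w)\<^sup>2 - x \<bullet> (Q2 *v x))" for x w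
          by (rule reachable_set_LMI[OF \<open>positive_definite X2\<close> XQ2 P lmi2])
      qed (use w \<open>t \<ge> 0\<close> in \<open>auto simp: power2_norm_eq_inner\<close>)
      then have "?c * (x t \<bullet> (Q2 *v x t)) \<le> ?c * w_max\<^sup>2" by (intro mult_left_mono) auto
      moreover have "(norm (K *v x t))\<^sup>2 \<le> ?c * (x t \<bullet> (Q2 *v x t))"
        by (rule input_bound_LMI[OF \<open>positive_definite X2\<close> XQ2 _ Y lmi3]) (use assms(1,2) in simp)
      ultimately have "(norm (K *v x t))\<^sup>2 \<le> u_lim\<^sup>2"
        using \<open>w_max > 0\<close> by simp
      then show ?thesis using \<open>u_lim > 0\<close> by (rule power2_le_imp_le[OF _ less_imp_le])
    qed
    then show ?thesis unfolding never_saturates_def by blast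
  qed
  moreover have "disturbance_attenuation_level ?A B1 ?C D11 \<gamma>_new"
    by (rule attenuation_from_strict_dissipation[OF Q1 \<open>hurwitz ?A\<close> \<open>\<gamma>_new > 0\<close> \<open>\<delta> > 0\<close> diss])
  ultimately show ?thesis by blast
qed

end
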